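(* Fix $n\ge1$, and let the discrete-time effective path delay operator $\bar\Psi:\bar\Lambda^n\to\mathbb{R}_+^{n\times|\mathcal{P}|}$ and the mappings $\bar\varepsilon_{ij}^p(\cdot):\bar\Lambda^n\to\mathbb{R}_{++}$, $p\in\mathcal{P}_{ij}$, $(i,j)\in\mathcal{W}$, be continuous. Let $\bar h^*$ be a solution of the discrete-time VT-BR-DUE problem with the (P) property. Then its child set $\mathcal{C}(\bar h^* )$ is connected.
   Context: $\mathcal{W}$ is a finite set of origin-destination (O-D) pairs; $\mathcal{P}$ is the finite set of paths, the disjoint union of the nonempty sets $\mathcal{P}_{ij}$, $(i,j)\in\mathcal{W}$; $Q_{ij}>0$ are given demands. $\mathbb{R}_+$ (resp. $\mathbb{R}_{++}$) denotes the nonnegative (resp. positive) reals. The feasible set is $$\Lambda=\Big\{h\in\big(L_+^2[t_0,t_f]\big)^{|\mathcal{P}|}:\ \sum_{p\in\mathcal{P}_{ij}}\int_{t_0}^{t_f}h_p(t)\,dt=Q_{ij}\ \ \forall (i,j)\in\mathcal{W}\Big\},$$ where $L^2_+$ denotes nonnegative $L^2$ functions. The effective path delay operator $\Psi:\Lambda\to(L_+^2[t_0,t_f])^{|\mathcal{P}|}$ gives the travel costs $\Psi_p(\cdot,h)$ (measurable, positive a.e., square integrable), and $\varepsilon_{ij}^p(\cdot):\Lambda\to\mathbb{R}_{++}$ are tolerance functionals. Discretization: $[t_0,t_f]$ is partitioned uniformly into $n$ subintervals $I_1,\dots,I_n$ of length $\delta t=(t_f-t_0)/n$. $\Lambda^n$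 is the set of $h\in\Lambda$ with every $h_p$ constant on every $I_k$. To $h\in\Lambda^n$ corresponds $\bar h=(\bar h_p(k))\in\mathbb{R}_+^{n\times|\mathcal{P}|}$ with $\bar h_p(k)=h_p(t)$, $t\in I_k$; the set of such vectors is $$\bar\Lambda^n=\Big\{\bar h\in\mathbb{R}_+^{n\times|\mathcal{P}|}:\ \delta t\sum_{p\in\mathcal{P}_{ij}}\sum_{k=1}^n\bar h_p(k)=Q_{ij}\ \ \forall(i,j)\in\mathcal{W}\Big\}.$$ For $\bar h\in\bar\Lambda^n$ with counterpart $h\in\Lambda^n$: $\bar\Psi_p(k,\bar h)=\frac{1}{|I_k|}\int_{I_k}\Psi_p(t,h)\,dt$, $\bar\varepsilon_{ij}^p(\bar h)=\varepsilon_{ij}^p(h)$, and $v_{ij}(\bar h)=\min_{1\le k\le n,\,p\in\mathcal{P}_{ij}}\bar\Psi_p(k,\bar h)$. Definition. $\bar h^*\in\bar\Lambda^n$ is a solution of the discrete-time VT-BR-DUE problem if for all $(i,j)\in\mathcal{W}$, $p\in\mathcal{P}_{ij}$, $1\le k\le n$: $\bar h_p^*(k)>0\Rightarrow\bar\Psi_p(k,\bar h^* )\in[v_{ij}(\bar h^* ),\,v_{ij}(\bar h^* )+\bar\varepsilon_{ij}^p(\bar h^* )]$. The solution set is denoted $\Omega^n$. (P) property. A solution $\bar h^*$ has the (P) property if for all $(i,j)\in\mathcal{W}$, $p\in\mathcal{P}_{ij}$, $1\le k\le n$: $\bar h_p^*(k)>0\Rightarrow\bar\Psi_p(k,\bar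 h^* )<v_{ij}(\bar h^* )+\bar\varepsilon_{ij}^p(\bar h^* )$. Fix a bijection $\mathcal{O}:\{(I_k,p)\}\to\{1,\dots,n\times|\mathcal{P}|\}$ labelling the coordinates of $\mathbb{R}^{n\times|\mathcal{P}|}$, with natural basis $\{\mathbf{e}_l\}$. For a solution $\bar h$ with the (P) property let $\mathcal{F}(\bar h)=\{\mathcal{O}(I_k,p):\ \bar\Psi_p(k,\bar h)<v_{ij}(\bar h)+\bar\varepsilon_{ij}^p(\bar h),\ p\in\mathcal{P}_{ij}\}$. Child set. For every solution $\bar h$ with the (P) property there is $\delta>0$ such that $\mathcal{B}_{\bar h}^{\delta}\cap\bar\Lambda^n\cap\operatorname{span}\{\mathbf{e}_l:l\in\mathcal{F}(\bar h)\}\subset\Omega^n$ and all points of this (convex) set have the (P) property, where $\mathcal{B}_{\bar h}^{\delta}$ is the ball of radius $\delta$ centered at $\bar h$. For each such $\bar h$ fix such a $\delta=\delta(\bar h)$ and denote the resulting set by $\mathcal{S}(\bar h)$; it contains $\bar h$. Starting from $\bar h^*$, one forms $\mathcal{S}(\bar h^* )$, then $\mathcal{S}(\bar h^2)$ for every $\bar h^2\in\mathcal{S}(\bar h^* )$, and so on until no more points can be included; the set obtained is the child set $\mathcal{C}(\bar h^* )$. That is, $\mathcal{C}(\bar h^* )$ is the smallest set containing $\bar h^*$ such that $\bar h\in\mathcal{C}(\bar h^* )$ implies $\mathcal{S}(\bar h)\subset\mathcal{C}(\bar h^* )$. A set is connected if it cannot be divided into two disjoint nonempty subsets that are open in the relative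 topology. *)

theory Defs
  imports "HOL-Analysis.Analysis"
begin

text \<open>
  Path flows and path delays are families of functions of time indexed by paths. Elements of
  \<open>L\<^sup>2[t0,tf]\<close> are represented by functions on the whole line, of which only the
  restriction to \<open>{t0..tf}\<close>, up to null sets, is relevant.
\<close>

type_synonym 'p profile = "'p \<Rightarrow> real \<Rightarrow> real"

definition L2_plus :: "real \<Rightarrow> real \<Rightarrow> (real \<Rightarrow> real) set" where
  "L2_plus a b = {f \<in> borel_measurable (lebesgue_on {a..b}).
     integrable (lebesgue_on {a..b}) (\<lambda>t. (f t)\<^sup>2) \<and> (AE t in lebesgue_on {a..b}. 0 \<le> f t)}"

text \<open>
  The type \<open>'m\<close> is the index type of the coordinates of \<open>\<real>\<close> to the power \<open>n |P|\<close>; the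
  field \<open>label\<close> is the bijection \<open>\<O>\<close>, so the component \<open>h\<^sub>p(k)\<close> of a vector \<open>h\<close> is
  \<open>h $ label M (k, p)\<close>.
\<close>

record ('v, 'p, 'm) due_model =
  t0 :: real
  tf :: real
  od_pairs :: "('v \<times> 'v) set"
  paths :: "'v \<times> 'v \<Rightarrow> 'p set"
  demand :: "'v \<times> 'v \<Rightarrow> real"
  delay :: "'p profile \<Rightarrow> 'p profile"
  tolerance :: "'v \<times> 'v \<Rightarrow> 'p \<Rightarrow> 'p profile \<Rightarrow> real"
  steps :: nat
  label :: "nat \<times> 'p \<Rightarrow> 'm"

definition all_paths :: "('v, 'p, 'm) due_model \<Rightarrow> 'p set" where
  "all_paths M = (\<Union>w\<in>od_pairs M. paths M w)"

definition Lambda :: "('v, 'p, 'm) due_model \<Rightarrow> 'p profile set" where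
  "Lambda M = {h. (\<forall>p\<in>all_paths M. h p \<in> L2_plus (t0 M) (tf M)) \<and>
     (\<forall>w\<in>od_pairs M. (\<Sum>p\<in>paths M w. integral\<^sup>L (lebesgue_on {t0 M..tf M}) (h p)) = demand M w)}"

definition ae_eq :: "('v, 'p, 'm) due_model \<Rightarrow> 'p profile \<Rightarrow> 'p profile \<Rightarrow> bool" where
  "ae_eq M h g \<longleftrightarrow> (\<forall>p\<in>all_paths M. AE t in lebesgue_on {t0 M..tf M}. h p t = g p t)"

text \<open>
  The conditions \<open>delay_ae\<close> and \<open>tolerance_ae\<close> say that the effective delay operator and the
  tolerance functionals are well defined on tuples of elements of \<open>L\<^sup>2\<close> indexed by
  the paths of the network.
\<close>

locale vt_br_due =
  fixes M :: "('v, 'p, 'm::finite) due_model"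
  assumes horizon: "t0 M < tf M"
    and finite_od_pairs: "finite (od_pairs M)"
    and finite_paths: "\<And>w. w \<in> od_pairs M \<Longrightarrow> finite (paths M w)"
    and nonempty_paths: "\<And>w. w \<in> od_pairs M \<Longrightarrow> paths M w \<noteq> {}"
    and disjoint_paths: "disjoint_family_on (paths M) (od_pairs M)"
    and demand_pos: "\<And>w. w \<in> od_pairs M \<Longrightarrow> 0 < demand M w"
    and delay_L2: "\<And>h p. h \<in> Lambda M \<Longrightarrow> p \<in> all_paths M \<Longrightarrow>
      delay M h p \<in> L2_plus (t0 M) (tf M)"
    and delay_pos: "\<And>h p. h \<in> Lambda M \<Longrightarrow> p \<in> all_paths M \<Longrightarrow>
      AE t in lebesgue_on {t0 M..tf M}. 0 < delay M h p t"
    and delay_ae: "\<And>h g. h \<in> Lambda M \<Longrightarrow> g \<in> Lambda M \<Longrightarrow> ae_eq M h g \<Longrightarrow>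
      ae_eq M (delay M h) (delay M g)"
    and tolerance_pos: "\<And>w p h. w \<in> od_pairs M \<Longrightarrow> p \<in> paths M w \<Longrightarrow> h \<in> Lambda M \<Longrightarrow>
      0 < tolerance M w p h"
    and tolerance_ae: "\<And>w p h g. w \<in> od_pairs M \<Longrightarrow> p \<in> paths M w \<Longrightarrow>
      h \<in> Lambda M \<Longrightarrow> g \<in> Lambda M \<Longrightarrow> ae_eq M h g \<Longrightarrow>
      tolerance M w p h = tolerance M w p g"
    and steps_pos: "1 \<le> steps M"
    and label_bij: "bij_betw (label M) ({1..steps M} \<times> all_paths M) UNIV"

definition dt :: "('v, 'p, 'm) due_model \<Rightarrow> real" where
  "dt M = (tf M - t0 M) / real (steps M)"

text \<open>Half-open subintervals, the last one closed, so that they partition \<open>{t0..tf}\<close>.\<close>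

definition subint :: "('v, 'p, 'm) due_model \<Rightarrow> nat \<Rightarrow> real set" where
  "subint M k = (let a = t0 M + (real k - 1) * dt M; b = t0 M + real k * dt M
                 in if k = steps M then {a..b} else {a..<b})"

definition Lambda_n :: "('v, 'p, 'm) due_model \<Rightarrow> 'p profile set" where
  "Lambda_n M = {h \<in> Lambda M. \<forall>p\<in>all_paths M. \<forall>k\<in>{1..steps M}. h p constant_on subint M k}"

definition Lambda_bar :: "('v, 'p, 'm::finite) due_model \<Rightarrow> (real ^ 'm) set" where
  "Lambda_bar M = {h. (\<forall>l. 0 \<le> h $ l) \<and>
     (\<forall>w\<in>od_pairs M. dt M * (\<Sum>p\<in>paths M w. \<Sum>k=1..steps M. h $ label M (k, p)) = demand M w)}"

text \<open>The piecewise constant counterpart of a vector; its values for \<open>p\<close> outside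
  \<open>all_paths M\<close> are irrelevant.\<close>

definition counterpart :: "('v, 'p, 'm::finite) due_model \<Rightarrow> real ^ 'm \<Rightarrow> 'p profile" where
  "counterpart M h p t = (\<Sum>k=1..steps M. h $ label M (k, p) * indicator (subint M k) t)"

text \<open>The vector-valued discrete-time delay operator; see \<open>Psi_bar_nth\<close> below for its components.\<close>

definition Psi_bar :: "('v, 'p, 'm::finite) due_model \<Rightarrow> real ^ 'm \<Rightarrow> real ^ 'm" where
  "Psi_bar M h = (\<chi> l. let (k, p) = the_inv_into ({1..steps M} \<times> all_paths M) (label M) l in
     1 / measure lebesgue (subint M k) *
     integral\<^sup>L (lebesgue_on (subint M k)) (delay M (counterpart M h) p))"

definition eps_bar ::
  "('v, 'p, 'm::finite) due_model \<Rightarrow> 'v \<times> 'v \<Rightarrow> 'p \<Rightarrow> real ^ 'm \<Rightarrow> real" where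
  "eps_bar M w p h = tolerance M w p (counterpart M h)"

definition min_cost :: "('v, 'p, 'm::finite) due_model \<Rightarrow> 'v \<times> 'v \<Rightarrow> real ^ 'm \<Rightarrow> real" where
  "min_cost M w h = Min ((\<lambda>(k, p). Psi_bar M h $ label M (k, p)) ` ({1..steps M} \<times> paths M w))"

definition Omega :: "('v, 'p, 'm::finite) due_model \<Rightarrow> (real ^ 'm) set" where
  "Omega M = {h \<in> Lambda_bar M. \<forall>w\<in>od_pairs M. \<forall>p\<in>paths M w. \<forall>k\<in>{1..steps M}.
     h $ label M (k, p) > 0 \<longrightarrow>
     Psi_bar M h $ label M (k, p) \<in> {min_cost M w h .. min_cost M w h + eps_bar M w p h}}"

definition P_property :: "('v, 'p, 'm::finite) due_model \<Rightarrow> real ^ 'm \<Rightarrow> bool" where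
  "P_property M h \<longleftrightarrow> (\<forall>w\<in>od_pairs M. \<forall>p\<in>paths M w. \<forall>k\<in>{1..steps M}.
     h $ label M (k, p) > 0 \<longrightarrow>
     Psi_bar M h $ label M (k, p) < min_cost M w h + eps_bar M w p h)"

definition F_set :: "('v, 'p, 'm::finite) due_model \<Rightarrow> real ^ 'm \<Rightarrow> 'm set" where
  "F_set M h = {label M (k, p) | k p w. w \<in> od_pairs M \<and> p \<in> paths M w \<and> k \<in> {1..steps M} \<and>
     Psi_bar M h $ label M (k, p) < min_cost M w h + eps_bar M w p h}"

text \<open>The function \<open>r\<close> is the choice of the radius \<open>\<delta>(h)\<close>.\<close>

definition S_set ::
  "('v, 'p, 'm::finite) due_model \<Rightarrow> (real ^ 'm \<Rightarrow> real) \<Rightarrow> real ^ 'm \<Rightarrow> (real ^ 'm) set" where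
  "S_set M r h = ball h (r h) \<inter> Lambda_bar M \<inter> span {axis l 1 | l. l \<in> F_set M h}"

definition admissible_radius ::
  "('v, 'p, 'm::finite) due_model \<Rightarrow> (real ^ 'm \<Rightarrow> real) \<Rightarrow> bool" where
  "admissible_radius M r \<longleftrightarrow> (\<forall>h\<in>Omega M. P_property M h \<longrightarrow>
     0 < r h \<and> S_set M r h \<subseteq> Omega M \<and> (\<forall>g\<in>S_set M r h. P_property M g))"

inductive_set child_set ::
  "('v, 'p, 'm::finite) due_model \<Rightarrow> (real ^ 'm \<Rightarrow> real) \<Rightarrow> real ^ 'm \<Rightarrow> (real ^ 'm) set"
  for M r hs where
    root: "hs \<in> child_set M r hs"
  | grow: "h \<in> child_set M r hs \<Longrightarrow> g \<in> S_set M r h \<Longrightarrow> g \<in> child_set M r hs"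

lemma (in vt_br_due) Psi_bar_nth:
  assumes "k \<in> {1..steps M}" "p \<in> all_paths M"
  shows "Psi_bar M h $ label M (k, p) = 1 / measure lebesgue (subint M k) *
     integral\<^sup>L (lebesgue_on (subint M k)) (delay M (counterpart M h) p)"
proof -
  have "the_inv_into ({1..steps M} \<times> all_paths M) (label M) (label M (k, p)) = (k, p)"
    using label_bij assms by (intro the_inv_into_f_f) (auto simp: bij_betw_def)
  then show ?thesis by (simp add: Psi_bar_def)
qed

lemma (in vt_br_due) dt_pos: "0 < dt M"
  using horizon steps_pos by (simp add: dt_def)

lemma (in vt_br_due) subint_disjoint:
  assumes "i \<in> {1..steps M}" "k \<in> {1..steps M}" "t \<in> subint M i" "t \<in> subint M k"
  shows "i = k"
proof -
  have *: False if "i < k" "i \<in> {1..steps M}" "k \<in> {1..steps M}" "t \<in> subint M i" "t \<in> subint M k"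
    for i k
  proof -
    have "real i * dt M \<le> (real k - 1) * dt M"
      using that dt_pos by (intro mult_right_mono) auto
    with that show False by (auto simp: subint_def Let_def split: if_splits)
  qed
  from *[of i k] *[of k i] assms show ?thesis by (cases i k rule: linorder_cases) auto
qed

lemma (in vt_br_due) subint_subset:
  assumes "k \<in> {1..steps M}"
  shows "subint M k \<subseteq> {t0 M..tf M}"
proof -
  have "0 \<le> (real k - 1) * dt M" using assms dt_pos by (intro mult_nonneg_nonneg) auto
  moreover have "real k * dt M \<le> real (steps M) * dt M"
    using assms dt_pos by (intro mult_right_mono) auto
  moreover have "real (steps M) * dt M = tf M - t0 M"
    using steps_pos by (simp add: dt_def)
  ultimately show ?thesis by (auto simp: subint_def Let_def)
qed

lemma (in vt_br_due) measure_subint: "measure lebesgue (subint M k) = dt M"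
  using dt_pos by (simp add: subint_def Let_def algebra_simps)

lemma (in vt_br_due) counterpart_eq:
  assumes "k \<in> {1..steps M}" "t \<in> subint M k"
  shows "counterpart M h p t = h $ label M (k, p)"
proof -
  have "counterpart M h p t = (\<Sum>i=1..steps M. if i = k then h $ label M (k, p) else 0)"
    unfolding counterpart_def using assms subint_disjoint
    by (intro sum.cong) (auto simp: indicator_def)
  then show ?thesis using assms by simp
qed

lemma (in vt_br_due) counterpart_in_Lambda_n:
  assumes h: "h \<in> Lambda_bar M"
  shows "counterpart M h \<in> Lambda_n M"
proof -
  let ?L = "lebesgue_on {t0 M..tf M}"
  have sets: "subint M k \<in> sets ?L" if "k \<in> {1..steps M}" for k
    using subint_subset[OF that] by (auto simp: sets_restrict_space_iff subint_def Let_def)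
  have meas: "measure ?L (subint M k) = dt M" if "k \<in> {1..steps M}" for k
    using subint_subset[OF that] measure_subint[of k] by (simp add: measure_restrict_space)
  have finm: "emeasure ?L A < \<infinity>" for A
    by (rule order.strict_trans1[OF emeasure_space])
       (simp add: space_restrict_space emeasure_restrict_space emeasure_lborel_Icc_eq)
  have intind: "integrable ?L (\<lambda>t. c * indicator (subint M k) t :: real)"
    if "k \<in> {1..steps M}" for k c
    using sets[OF that] finm by simp
  have cb: "counterpart M h p \<in> borel_measurable ?L" for p
    unfolding counterpart_def using sets by (intro borel_measurable_sum) simp_all
  have nn: "0 \<le> counterpart M h p t" for p t
    using h unfolding counterpart_def by (intro sum_nonneg) (simp add: Lambda_bar_def)
  have sq: "(counterpart M h p t)\<^sup>2 =
      (\<Sum>k=1..steps M. (h $ label M (k, p))\<^sup>2 * indicator (subint M k) t)" for p t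
  proof (cases "\<exists>k\<in>{1..steps M}. t \<in> subint M k")
    case True
    then obtain k where k: "k \<in> {1..steps M}" "t \<in> subint M k" by auto
    have "(\<Sum>i=1..steps M. (h $ label M (i, p))\<^sup>2 * indicator (subint M i) t) =
        (\<Sum>i=1..steps M. if i = k then (h $ label M (k, p))\<^sup>2 else 0)"
      using k subint_disjoint by (intro sum.cong) (auto simp: indicator_def)
    then show ?thesis using k counterpart_eq[OF k] by simp
  next
    case False
    then show ?thesis by (simp add: counterpart_def)
  qed
  have L2: "counterpart M h p \<in> L2_plus (t0 M) (tf M)" for p
    unfolding L2_plus_def mem_Collect_eq sq
    using cb nn intind by (intro conjI Bochner_Integration.integrable_sum) auto
  have int: "integral\<^sup>L ?L (counterpart M h p) = dt M * (\<Sum>k=1..steps M. h $ label M (k, p))" for p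
  proof -
    have "integral\<^sup>L ?L (counterpart M h p) =
        (\<Sum>k=1..steps M. integral\<^sup>L ?L (\<lambda>t. h $ label M (k, p) * indicator (subint M k) t))"
      unfolding counterpart_def using intind by (intro Bochner_Integration.integral_sum) auto
    also have "\<dots> = (\<Sum>k=1..steps M. h $ label M (k, p) * dt M)"
      using meas sets subint_subset
      by (intro sum.cong) (simp_all add: Int_absorb2)
    finally show ?thesis by (simp add: sum_distrib_left mult.commute)
  qed
  have "counterpart M h \<in> Lambda M"
    using h L2 by (auto simp: Lambda_def int Lambda_bar_def sum_distrib_left)
  moreover have "counterpart M h p constant_on subint M k" if "k \<in> {1..steps M}" for p k
    unfolding constant_on_def using counterpart_eq[OF that] by blast
  ultimately show ?thesis by (auto simp: Lambda_n_def)
qed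

end

theory Submission
  imports Defs
begin

text \<open>Every set \<open>S(h)\<close> attached to a solution with the (P) property is convex and
  contains its base point, because (P) puts the support of \<open>h\<close> into the span used to define
  \<open>S(h)\<close>. So each growth step of the child set stays in the connected component of the root.\<close>

lemma convex_Lambda_bar:
  fixes M :: "('v, 'p, 'm::finite) due_model"
  shows "convex (Lambda_bar M)"
proof (rule convexI)
  fix x y :: "real ^ 'm" and u v :: real
  assume x: "x \<in> Lambda_bar M" and y: "y \<in> Lambda_bar M"
    and uv: "0 \<le> u" "0 \<le> v" "u + v = 1"
  have "dt M * (\<Sum>p\<in>paths M w. \<Sum>k=1..steps M. (u *\<^sub>R x + v *\<^sub>R y) $ label M (k, p)) = demand M w"
    if w: "w \<in> od_pairs M" for w
  proof -
    have "dt M * (\<Sum>p\<in>paths M w. \<Sum>k=1..steps M. (u *\<^sub>R x + v *\<^sub>R y) $ label M (k, p)) =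
        u * (dt M * (\<Sum>p\<in>paths M w. \<Sum>k=1..steps M. x $ label M (k, p))) +
        v * (dt M * (\<Sum>p\<in>paths M w. \<Sum>k=1..steps M. y $ label M (k, p)))"
      by (simp add: sum.distrib sum_distrib_left distrib_left mult.left_commute)
    also have "\<dots> = (u + v) * demand M w"
      using x y w by (simp add: Lambda_bar_def distrib_right)
    finally show ?thesis using uv by simp
  qed
  moreover have "0 \<le> (u *\<^sub>R x + v *\<^sub>R y) $ l" for l
    using x y uv by (simp add: Lambda_bar_def)
  ultimately show "u *\<^sub>R x + v *\<^sub>R y \<in> Lambda_bar M"
    unfolding Lambda_bar_def by blast
qed

lemma convex_S_set: "convex (S_set M r h)"
  unfolding S_set_def
  by (intro convex_Int convex_ball convex_Lambda_bar subspace_imp_convex subspace_span)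

text \<open>Expand \<open>h\<close> along the natural basis: the terms with index outside
  \<open>F\<close> have coefficient zero, so only vectors \<open>axis l 1\<close> with
  \<open>l\<close> in \<open>F\<close> contribute.\<close>

lemma in_span_axes:
  fixes h :: "real ^ 'm::finite"
  assumes "\<And>l. h $ l \<noteq> 0 \<Longrightarrow> l \<in> F"
  shows "h \<in> span {axis l 1 | l. l \<in> F}"
proof -
  have "h $ l *\<^sub>R (axis l 1 :: real ^ 'm) \<in> span {axis l 1 | l. l \<in> F}" for l
  proof (cases "h $ l = 0")
    case True
    then show ?thesis by (simp add: span_zero)
  next
    case False
    then show ?thesis using assms[of l] by (intro span_mul span_base) blast
  qed
  then have "(\<Sum>l\<in>UNIV. h $ l *\<^sub>R (axis l 1 :: real ^ 'm)) \<in> span {axis l 1 | l. l \<in> F}"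
    by (intro span_sum)
  then show ?thesis
    using basis_expansion[of h] by (simp add: scalar_mult_eq_scaleR)
qed

context vt_br_due
begin

text \<open>At positive coordinates, (P) supplies the strict cost bound that defines
  \<open>F_set\<close>; membership in \<open>Omega M\<close> alone would give only the weak
  one.\<close>

lemma support_subset_F_set:
  assumes h: "h \<in> Omega M" "P_property M h" and nz: "h $ l \<noteq> 0"
  shows "l \<in> F_set M h"
proof -
  \<comment> \<open>The labelling is onto, so every coordinate comes from a time step and a
    path.\<close>
  have "l \<in> label M ` ({1..steps M} \<times> all_paths M)"
    using label_bij by (simp add: bij_betw_def)
  then obtain k p w where kpw: "l = label M (k, p)" "k \<in> {1..steps M}"
      "w \<in> od_pairs M" "p \<in> paths M w"
    by (auto simp: all_paths_def)
  \<comment> \<open>Feasible vectors are nonnegative, so a nonzero coordinate is positive and (P)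
    applies to it.\<close>
  have "0 < h $ l"
    using h(1) nz by (simp add: Omega_def Lambda_bar_def order_less_le)
  with h(2) kpw have "Psi_bar M h $ label M (k, p) < min_cost M w h + eps_bar M w p h"
    unfolding P_property_def by blast
  then show ?thesis unfolding F_set_def using kpw by blast
qed

lemma self_in_S_set:
  assumes "admissible_radius M r" "h \<in> Omega M" "P_property M h"
  shows "h \<in> S_set M r h"
proof -
  have "h \<in> span {axis l 1 | l. l \<in> F_set M h}"
    using assms by (intro in_span_axes support_subset_F_set)
  then show ?thesis
    using assms by (auto simp: S_set_def admissible_radius_def Omega_def)
qed

text \<open>Admissibility constrains \<open>r\<close> only at solutions with (P). This invariant of
  the growth process makes it applicable at every point reached.\<close>

lemma child_set_solution:
  assumes r: "admissible_radius M r" and hs: "hs \<in> Omega M" "P_property M hs"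
    and g: "g \<in> child_set M r hs"
  shows "g \<in> Omega M \<and> P_property M g"
  using g by induction (use r hs in \<open>auto simp: admissible_radius_def\<close>)

lemma connected_component_child_set:
  assumes r: "admissible_radius M r" and hs: "hs \<in> Omega M" "P_property M hs"
    and g: "g \<in> child_set M r hs"
  shows "connected_component (child_set M r hs) hs g"
  using g
proof induction
  case root
  then show ?case by (simp add: connected_component_refl child_set.root)
next
  case (grow h g)
  have "h \<in> S_set M r h"
    using self_in_S_set[OF r] child_set_solution[OF r hs grow.hyps(1)] by blast
  \<comment> \<open>The component is taken relative to the child set, so the convex set joining
    \<open>h\<close> to \<open>g\<close> must lie inside it.\<close>
  moreover have "S_set M r h \<subseteq> child_set M r hs"
    using grow.hyps(1) by (auto intro: child_set.grow)
  ultimately have "connected_component (child_set M r hs) h g"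
    unfolding connected_component_def
    using convex_connected[OF convex_S_set[of M r h]] grow.hyps(2) by blast
  with grow.IH show ?case by (rule connected_component_trans)
qed

end

theorem proposition6p9:
  fixes M :: "('v, 'p, 'm::finite) due_model"
    and r :: "real ^ 'm \<Rightarrow> real"
    and hs :: "real ^ 'm"
  assumes "vt_br_due M"
    and "continuous_on (Lambda_bar M) (Psi_bar M)"
    and "\<And>w p. w \<in> od_pairs M \<Longrightarrow> p \<in> paths M w \<Longrightarrow> continuous_on (Lambda_bar M) (eps_bar M w p)"
    and "admissible_radius M r"
    and "hs \<in> Omega M"
    and "P_property M hs"
  shows "connected (child_set M r hs)"
proof -
  interpret vt_br_due M by fact
  \<comment> \<open>Any two points of the child set are joined through the root
    \<open>hs\<close>.\<close>
  show ?thesis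
    unfolding connected_iff_connected_component
    using connected_component_child_set[OF assms(4-6)]
    by (blast intro: connected_component_trans connected_component_sym)
qed

end
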